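(* Let $n\ge 1$. Every element $\alpha\in\mathcal{ODCT}_n$ can be expressed as $$\alpha=\begin{pmatrix} A_1 & A_2 & \cdots & A_p\\ 1 & 2 & \cdots & p\end{pmatrix}\qquad (1\le p\le n),$$ that is, for some $1\le p\le n$ the kernel classes of $\alpha$ can be listed as $A_1<A_2<\cdots<A_p$, with $A_i\alpha=\{i\}$ for every $1\le i\le p$.
   Context: $[n]=\{1,2,\ldots,n\}$ with its usual order. Maps are written on the right of their arguments. $\mathcal{ODCT}_n$ is the semigroup (under composition, $x(\alpha\beta)=(x\alpha)\beta$) of all maps $\alpha:[n]\to[n]$ that are contractions ($|x\alpha-y\alpha|\le|x-y|$ for all $x,y\in[n]$), order-preserving ($x\le y\Rightarrow x\alpha\le y\alpha$) and order-decreasing ($x\alpha\le x$ for all $x\in[n]$). The kernel classes of $\alpha$ are the equivalence classes of the relation $\{(x,y)\in[n]\times[n]: x\alpha=y\alpha\}$. For nonempty subsets $A,B$ of $[n]$, $A<B$ means that every element of $A$ is less than every element of $B$. *)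

theory Defs
  imports "HOL-Library.FuncSet"
begin

text \<open>Maps on \<open>{1..n}\<close> are extensional functions, so that \<open>ODCT n\<close> contains each map exactly once.
  The contraction inequality is read in the integers, where subtraction does not truncate.\<close>

definition ODCT :: "nat \<Rightarrow> (nat \<Rightarrow> nat) set" where
  "ODCT n = {\<alpha> \<in> {1..n} \<rightarrow>\<^sub>E {1..n}.
     (\<forall>x\<in>{1..n}. \<forall>y\<in>{1..n}. \<bar>int (\<alpha> x) - int (\<alpha> y)\<bar> \<le> \<bar>int x - int y\<bar>) \<and>
     mono_on {1..n} \<alpha> \<and>
     (\<forall>x\<in>{1..n}. \<alpha> x \<le> x)}"

definition kernel_rel :: "nat \<Rightarrow> (nat \<Rightarrow> nat) \<Rightarrow> (nat \<times> nat) set" where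
  "kernel_rel n \<alpha> = {(x, y) \<in> {1..n} \<times> {1..n}. \<alpha> x = \<alpha> y}"

definition kernel_classes :: "nat \<Rightarrow> (nat \<Rightarrow> nat) \<Rightarrow> nat set set" where
  "kernel_classes n \<alpha> = {1..n} // kernel_rel n \<alpha>"

definition set_less :: "nat set \<Rightarrow> nat set \<Rightarrow> bool" where
  "set_less A B \<longleftrightarrow> (\<forall>a\<in>A. \<forall>b\<in>B. a < b)"

end

theory Submission
  imports Defs
begin

text \<open>A decreasing map fixes the least point \<open>1\<close>, and a contraction moves by at most one between
  neighbouring points. Hence, by the discrete intermediate value theorem, the image of \<open>\<alpha>\<close> has no
  gaps: it is exactly \<open>{1..\<alpha> n}\<close>, where \<open>\<alpha> n\<close> is the maximum by monotonicity. So \<open>p = \<alpha> n\<close>, and the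
  kernel classes are the fibres of \<open>\<alpha>\<close> over \<open>1, \<dots>, p\<close>; monotonicity orders the fibres in the
  same way as their values.\<close>

text \<open>Indexing the fibres by the values that occur keeps them nonempty, so that distinct indices give
  distinct classes.\<close>

lemma bij_betw_fibres_kernel_classes:
  "bij_betw (\<lambda>i. {x \<in> {1..n}. \<alpha> x = i}) (\<alpha> ` {1..n}) (kernel_classes n \<alpha>)"
proof (rule bij_betw_imageI)
  show "inj_on (\<lambda>i. {x \<in> {1..n}. \<alpha> x = i}) (\<alpha> ` {1..n})"
    by (rule inj_onI) blast
  have "kernel_rel n \<alpha> `` {x} = {y \<in> {1..n}. \<alpha> y = \<alpha> x}" if "x \<in> {1..n}" for x
    using that by (auto simp: kernel_rel_def)
  then show "(\<lambda>i. {x \<in> {1..n}. \<alpha> x = i}) ` \<alpha> ` {1..n} = kernel_classes n \<alpha>"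
    by (simp add: kernel_classes_def quotient_def image_image UNION_singleton_eq_range)
qed

text \<open>The values start at \<open>1\<close> and climb to \<open>\<alpha> n\<close> in steps of size at most one, so none is skipped.\<close>

lemma ODCT_image:
  assumes "n \<ge> 1" and "\<alpha> \<in> ODCT n"
  shows "\<alpha> ` {1..n} = {1..\<alpha> n}"
proof
  show "\<alpha> ` {1..n} \<subseteq> {1..\<alpha> n}"
  proof
    fix k assume "k \<in> \<alpha> ` {1..n}"
    then obtain x where x: "x \<in> {1..n}" "k = \<alpha> x" by blast
    have "mono_on {1..n} \<alpha>" using assms by (simp add: ODCT_def)
    then have "\<alpha> x \<le> \<alpha> n" by (rule mono_onD) (use x in auto)
    moreover have "\<alpha> x \<in> {1..n}"
      using assms x(1) unfolding ODCT_def by blast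
    ultimately show "k \<in> {1..\<alpha> n}" using x by simp
  qed
next
  have contraction: "\<bar>int (\<alpha> x) - int (\<alpha> y)\<bar> \<le> \<bar>int x - int y\<bar>"
    if "x \<in> {1..n}" "y \<in> {1..n}" for x y
    using assms that unfolding ODCT_def by blast
  have one: "\<alpha> 1 \<le> 1"
    using assms by (simp add: ODCT_def)
  show "{1..\<alpha> n} \<subseteq> \<alpha> ` {1..n}"
  proof
    fix k assume k: "k \<in> {1..\<alpha> n}"
    have "\<exists>i. 1 \<le> i \<and> i \<le> n \<and> int (\<alpha> i) = int k"
    proof (rule nat_intermed_int_val)
      show "\<forall>i. 1 \<le> i \<and> i < n \<longrightarrow> \<bar>int (\<alpha> (Suc i)) - int (\<alpha> i)\<bar> \<le> 1"
      proof (intro allI impI)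
        fix i assume "1 \<le> i \<and> i < n"
        then show "\<bar>int (\<alpha> (Suc i)) - int (\<alpha> i)\<bar> \<le> 1"
          using contraction[of "Suc i" i] by simp
      qed
    qed (use assms k one in auto)
    then show "k \<in> \<alpha> ` {1..n}" by auto
  qed
qed

theorem lemma1:
  fixes n :: nat and \<alpha> :: "nat \<Rightarrow> nat"
  assumes "n \<ge> 1" and "\<alpha> \<in> ODCT n"
  shows "\<exists>(p::nat) (A :: nat \<Rightarrow> nat set).
    1 \<le> p \<and> p \<le> n \<and>
    bij_betw A {1..p} (kernel_classes n \<alpha>) \<and>
    (\<forall>i\<in>{1..p}. \<forall>j\<in>{1..p}. i < j \<longrightarrow> set_less (A i) (A j)) \<and>
    (\<forall>i\<in>{1..p}. \<alpha> ` A i = {i})"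
proof -
  define A where "A i = {x \<in> {1..n}. \<alpha> x = i}" for i
  have img: "\<alpha> ` {1..n} = {1..\<alpha> n}"
    using ODCT_image[OF assms] .
  have mono: "mono_on {1..n} \<alpha>" and "\<alpha> \<in> {1..n} \<rightarrow>\<^sub>E {1..n}"
    using assms by (simp_all add: ODCT_def)
  moreover have "n \<in> {1..n}" using assms(1) by simp
  ultimately have "\<alpha> n \<in> {1..n}" by blast
  then have p: "1 \<le> \<alpha> n" "\<alpha> n \<le> n"
    by simp_all
  have "bij_betw A {1..\<alpha> n} (kernel_classes n \<alpha>)"
    using bij_betw_fibres_kernel_classes[of n \<alpha>] unfolding img A_def .
  moreover have "set_less (A i) (A j)" if "i < j" for i j
    unfolding set_less_def
  proof (intro ballI)
    fix a b assume ab: "a \<in> A i" "b \<in> A j"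
    show "a < b"
    proof (rule ccontr)
      assume "\<not> a < b"
      then have "\<alpha> b \<le> \<alpha> a" using ab by (intro mono_onD[OF mono]) (auto simp: A_def)
      then show False using ab that by (simp add: A_def)
    qed
  qed
  moreover have "\<alpha> ` A i = {i}" if "i \<in> {1..\<alpha> n}" for i
  proof -
    have "i \<in> \<alpha> ` {1..n}" using that img by simp
    then show ?thesis by (auto simp: A_def)
  qed
  ultimately show ?thesis
    using p by (intro exI[of _ "\<alpha> n"] exI[of _ A]) simp
qed

end
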